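(* Let $\psi:[0,\infty)\to(0,\infty)$ be a positive function with a completely monotone derivative, and let $\psi_{[0,\pi]}$ be its restriction to $[0,\pi]$. Define, for $\theta\in[0,\pi]$ and $u\in\mathbb{R}$, $$C(\theta,u)=e^{-|u|}\,\mathrm{erfc}\!\left(\sqrt{\psi_{[0,\pi]}(\theta)}-\frac{|u|}{2\sqrt{\psi_{[0,\pi]}(\theta)}}\right)+e^{|u|}\,\mathrm{erfc}\!\left(\sqrt{\psi_{[0,\pi]}(\theta)}+\frac{|u|}{2\sqrt{\psi_{[0,\pi]}(\theta)}}\right).$$ Then $C$ is a covariance function on $\mathbb{S}^d\times\mathbb{R}$ for every $d=1,2,\ldots$.
   Context: $\mathrm{erfc}(t)=\frac{2}{\sqrt\pi}\int_t^\infty e^{-\xi^2}d\xi$ for $t\in\mathbb{R}$ (complementary error function). A function $f$ on $(0,\infty)$ is completely monotone if it is infinitely differentiable with $(-1)^nf^{(n)}(t)\ge0$ for all $n\ge0$, $t>0$. $\mathbb{S}^d=\{\mathbf{s}\in\mathbb{R}^{d+1}:\|\mathbf{s}\|=1\}$ with great circle distance $\theta(\mathbf{s}_1,\mathbf{s}_2)=\arccos(\mathbf{s}_1^\top\mathbf{s}_2)$. $C:[0,\pi]\times\mathbb{R}\to\mathbb{R}$ is a covariance function on $\mathbb{S}^d\times\mathbb{R}$ if for every finite collection $(\mathbf{s}_k,t_k)\in\mathbb{S}^d\times\mathbb{R}$ and reals $a_k$, $\sum_{k,h}a_ka_hC(\theta(\mathbf{s}_k,\mathbf{s}_h),t_k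-t_h)\ge0$.
   Formalization: The formal theorem additionally assumes that ψ is continuous from the right at 0; with the derivative only required on (0,∞), the claim fails otherwise (e.g. ψ(0)=10 and ψ(t)=1 for t>0). *)

theory Defs
  imports "HOL-Analysis.Analysis"
begin

definition erfc :: "real \<Rightarrow> real" where
  "erfc t = 2 / sqrt pi * integral {t..} (\<lambda>\<xi>. exp (- (\<xi>^2)))"

definition completely_monotone :: "(real \<Rightarrow> real) \<Rightarrow> bool" where
  "completely_monotone f \<longleftrightarrow>
     (\<forall>n. \<forall>t>0. (deriv ^^ n) f differentiable (at t)) \<and>
     (\<forall>n. \<forall>t>0. (-1)^n * (deriv ^^ n) f t \<ge> 0)"

definition gc_dist :: "'a::real_inner \<Rightarrow> 'a \<Rightarrow> real" where
  "gc_dist s1 s2 = arccos (s1 \<bullet> s2)"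

text \<open>C is a covariance function on S^d x R, where S^d is the unit sphere of the
  Euclidean space 'a (so d = DIM('a) - 1).\<close>
definition is_covariance_sphere_time ::
    "'a::euclidean_space itself \<Rightarrow> (real \<Rightarrow> real \<Rightarrow> real) \<Rightarrow> bool" where
  "is_covariance_sphere_time _ C \<longleftrightarrow>
     (\<forall>(n::nat) (s::nat \<Rightarrow> 'a) (t::nat \<Rightarrow> real) (a::nat \<Rightarrow> real).
        (\<forall>k<n. norm (s k) = 1) \<longrightarrow>
        0 \<le> (\<Sum>k<n. \<Sum>h<n. a k * a h * C (gc_dist (s k) (s h)) (t k - t h)))"

end

theory Submission
  imports Defs "HOL-Probability.Characteristic_Functions" "HOL-Real_Asymp.Real_Asymp"
begin

text \<open>
  Differentiating in c and comparing limits at infinity gives the Fourier representation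
  C(c, u) = (2/pi) \<integral> cos(w u) exp(-(1 + w^2) c) / (1 + w^2) dw, so with c = psi(theta) it suffices
  that cos(w (t_k - t_h)) and exp(-a psi(theta(s_k, s_h))), for a \<ge> 0, are positive semidefinite.
  On the sphere pi - theta = pi/2 + arcsin(s_k \<bullet> s_h) is positive semidefinite, as
  arcsin(r x) = \<integral> x / sqrt(1 - x^2 z^2) dz over [0, r] has a binomial series with nonnegative
  coefficients. For e > 0, Taylor expansion at pi + e writes psi(pi + e) - psi(theta + e) as a power
  series in pi - theta whose coefficients are nonnegative by complete monotonicity, and it converges by
  Bernstein's argument; so no integral representation of psi is required. Now exponentiate
  and let e tend to 0.
\<close>

subsection \<open>Positive semidefinite kernels\<close>

text \<open>Only the quadratic form is constrained, so the condition sees just the symmetric part of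
  \<open>K\<close>. Over an infinite \<open>I\<close> the sum takes its default value 0.\<close>

definition psd :: "'i set \<Rightarrow> ('i \<Rightarrow> 'i \<Rightarrow> real) \<Rightarrow> bool" where
  "psd I K \<longleftrightarrow> (\<forall>a. 0 \<le> (\<Sum>k\<in>I. \<Sum>h\<in>I. a k * a h * K k h))"

text \<open>
  For symmetric K this is equivalent to positive semidefiniteness (Schur product theorem); the definition makes
  closure under entrywise products immediate without that theorem.
\<close>

definition schur_psd :: "'i set \<Rightarrow> ('i \<Rightarrow> 'i \<Rightarrow> real) \<Rightarrow> bool" where
  "schur_psd I K \<longleftrightarrow> (\<forall>L. psd I L \<longrightarrow> psd I (\<lambda>k h. K k h * L k h))"

lemma schur_psdD: "schur_psd I K \<Longrightarrow> psd I L \<Longrightarrow> psd I (\<lambda>k h. K k h * L k h)"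
  by (simp add: schur_psd_def)

lemma psd_1: "psd I (\<lambda>k h. 1)"
  unfolding psd_def
proof
  fix a :: "'a \<Rightarrow> real"
  have "(\<Sum>k\<in>I. \<Sum>h\<in>I. a k * a h * 1) = (\<Sum>k\<in>I. a k)\<^sup>2"
    by (simp add: power2_eq_square sum_product)
  then show "0 \<le> (\<Sum>k\<in>I. \<Sum>h\<in>I. a k * a h * 1)" by simp
qed

lemma schur_psd_imp_psd: "schur_psd I K \<Longrightarrow> psd I K"
  using schur_psdD[OF _ psd_1] by fastforce

lemma schur_psd_cong:
  assumes "schur_psd I K" "\<And>k h. k \<in> I \<Longrightarrow> h \<in> I \<Longrightarrow> K k h = K' k h"
  shows "schur_psd I K'"
proof -
  have "(\<Sum>k\<in>I. \<Sum>h\<in>I. a k * a h * (K' k h * L k h))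
      = (\<Sum>k\<in>I. \<Sum>h\<in>I. a k * a h * (K k h * L k h))" for a :: "_ \<Rightarrow> real" and L
    using assms(2) by (intro sum.cong) auto
  with assms(1) show ?thesis unfolding schur_psd_def psd_def by simp
qed

lemma schur_psd_add:
  assumes "schur_psd I K" "schur_psd I K'"
  shows "schur_psd I (\<lambda>k h. K k h + K' k h)"
  using assms unfolding schur_psd_def psd_def
  by (auto simp: distrib_left distrib_right sum.distrib intro!: add_nonneg_nonneg)

lemma schur_psd_cmult:
  assumes "schur_psd I K" "0 \<le> c"
  shows "schur_psd I (\<lambda>k h. c * K k h)"
proof -
  have "(\<Sum>k\<in>I. \<Sum>h\<in>I. a k * a h * (c * K k h * L k h))
      = c * (\<Sum>k\<in>I. \<Sum>h\<in>I. a k * a h * (K k h * L k h))" for a :: "_ \<Rightarrow> real" and L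
    by (simp add: sum_distrib_left mult_ac)
  with assms show ?thesis unfolding schur_psd_def psd_def by simp
qed

lemma schur_psd_1: "schur_psd I (\<lambda>k h. 1)"
  by (simp add: schur_psd_def)

lemma schur_psd_const: "0 \<le> c \<Longrightarrow> schur_psd I (\<lambda>k h. c)"
  using schur_psd_cmult[OF schur_psd_1, of c] by simp

lemma schur_psd_mult:
  assumes "schur_psd I K" "schur_psd I K'"
  shows "schur_psd I (\<lambda>k h. K k h * K' k h)"
  using assms unfolding schur_psd_def by (simp add: mult.assoc)

lemma schur_psd_power: "schur_psd I K \<Longrightarrow> schur_psd I (\<lambda>k h. K k h ^ m)"
  by (induction m) (simp_all add: schur_psd_1 schur_psd_mult)

text \<open>The factors are absorbed into the coefficients: the form of the product at
  \<open>a\<close> is the form of \<open>L\<close> at \<open>\<lambda>k. a k * v k\<close>.\<close>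

lemma schur_psd_rank_one: "schur_psd I (\<lambda>k h. v k * v h)"
  unfolding schur_psd_def psd_def
proof (intro allI impI)
  fix L :: "'a \<Rightarrow> 'a \<Rightarrow> real" and a :: "'a \<Rightarrow> real"
  assume "\<forall>a. 0 \<le> (\<Sum>k\<in>I. \<Sum>h\<in>I. a k * a h * L k h)"
  from this[rule_format, of "\<lambda>k. a k * v k"]
  show "0 \<le> (\<Sum>k\<in>I. \<Sum>h\<in>I. a k * a h * (v k * v h * L k h))"
    by (simp add: mult_ac)
qed

lemma schur_psd_sum:
  "(\<And>m. m \<in> M \<Longrightarrow> schur_psd I (K m)) \<Longrightarrow> schur_psd I (\<lambda>k h. \<Sum>m\<in>M. K m k h)"
  by (induction M rule: infinite_finite_induct)
     (simp_all add: schur_psd_const schur_psd_add)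

text \<open>For fixed coefficients the quadratic form is continuous in the entries, and
  nonnegativity survives limits. A general filter covers both sequences and one-sided
  limits.\<close>

lemma schur_psd_tendsto:
  fixes K' :: "'i \<Rightarrow> 'i \<Rightarrow> real"
  assumes lim: "\<And>k h. k \<in> I \<Longrightarrow> h \<in> I \<Longrightarrow> ((\<lambda>m. K m k h) \<longlongrightarrow> K' k h) F"
    and ev: "\<forall>\<^sub>F m in F. schur_psd I (K m)" and "F \<noteq> bot"
  shows "schur_psd I K'"
  unfolding schur_psd_def psd_def
proof (intro allI impI)
  fix L :: "'i \<Rightarrow> 'i \<Rightarrow> real" and a :: "'i \<Rightarrow> real"
  assume L: "\<forall>a. 0 \<le> (\<Sum>k\<in>I. \<Sum>h\<in>I. a k * a h * L k h)"
  show "0 \<le> (\<Sum>k\<in>I. \<Sum>h\<in>I. a k * a h * (K' k h * L k h))"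
  proof (rule tendsto_lowerbound)
    show "((\<lambda>m. \<Sum>k\<in>I. \<Sum>h\<in>I. a k * a h * (K m k h * L k h))
            \<longlongrightarrow> (\<Sum>k\<in>I. \<Sum>h\<in>I. a k * a h * (K' k h * L k h))) F"
      by (intro tendsto_sum tendsto_mult tendsto_const lim)
    show "\<forall>\<^sub>F m in F. 0 \<le> (\<Sum>k\<in>I. \<Sum>h\<in>I. a k * a h * (K m k h * L k h))"
      using ev by eventually_elim (use L in \<open>simp add: schur_psd_def psd_def\<close>)
  qed fact
qed

text \<open>The partial sums are nonnegative combinations of entrywise powers; the limit follows
  entry by entry.\<close>

lemma schur_psd_power_series:
  assumes "schur_psd I K" "\<And>m. 0 \<le> c m"
    and sums: "\<And>k h. k \<in> I \<Longrightarrow> h \<in> I \<Longrightarrow> (\<lambda>m. c m * K k h ^ m) sums K' k h"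
  shows "schur_psd I K'"
proof (rule schur_psd_tendsto[where F = sequentially])
  show "(\<lambda>M. \<Sum>m<M. c m * K k h ^ m) \<longlonglongrightarrow> K' k h" if "k \<in> I" "h \<in> I" for k h
    using sums[OF that] by (simp add: sums_def)
  show "\<forall>\<^sub>F M in sequentially. schur_psd I (\<lambda>k h. \<Sum>m<M. c m * K k h ^ m)"
    using assms by (intro always_eventually allI schur_psd_sum schur_psd_cmult schur_psd_power)
qed simp

lemma schur_psd_exp:
  assumes "schur_psd I K"
  shows "schur_psd I (\<lambda>k h. exp (K k h))"
  using assms
proof (rule schur_psd_power_series)
  show "(\<lambda>m. inverse (fact m) * K k h ^ m) sums exp (K k h)" for k h
    using exp_converges[of "K k h"] by simp
qed simp

text \<open>By linearity, the quadratic form of the integrated kernel is the integral of nonnegative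
  quadratic forms.\<close>

lemma schur_psd_has_integral:
  fixes K :: "real \<Rightarrow> 'i \<Rightarrow> 'i \<Rightarrow> real"
  assumes "finite I" "\<And>x. x \<in> S \<Longrightarrow> schur_psd I (K x)"
    and int: "\<And>k h. k \<in> I \<Longrightarrow> h \<in> I \<Longrightarrow> ((\<lambda>x. K x k h) has_integral K' k h) S"
  shows "schur_psd I K'"
  unfolding schur_psd_def psd_def
proof (intro allI impI)
  fix L :: "'i \<Rightarrow> 'i \<Rightarrow> real" and a :: "'i \<Rightarrow> real"
  assume L: "\<forall>a. 0 \<le> (\<Sum>k\<in>I. \<Sum>h\<in>I. a k * a h * L k h)"
  have "((\<lambda>x. \<Sum>k\<in>I. \<Sum>h\<in>I. a k * a h * (K x k h * L k h))
      has_integral (\<Sum>k\<in>I. \<Sum>h\<in>I. a k * a h * (K' k h * L k h))) S"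
    by (intro has_integral_sum \<open>finite I\<close> has_integral_mult_right has_integral_mult_left int)
  then show "0 \<le> (\<Sum>k\<in>I. \<Sum>h\<in>I. a k * a h * (K' k h * L k h))"
    by (rule has_integral_nonneg) (use assms(2) L in \<open>simp add: schur_psd_def psd_def\<close>)
qed

section \<open>Inner product, cosine and arcsine kernels\<close>

text \<open>A Gram kernel is a sum of rank one kernels, one for each coordinate.\<close>

lemma schur_psd_inner:
  fixes s :: "'i \<Rightarrow> 'a::euclidean_space"
  shows "schur_psd I (\<lambda>k h. s k \<bullet> s h)"
proof (rule schur_psd_cong)
  show "schur_psd I (\<lambda>k h. \<Sum>b\<in>Basis. (s k \<bullet> b) * (s h \<bullet> b))"
    by (intro schur_psd_sum schur_psd_rank_one)
  show "(\<Sum>b\<in>Basis. (s k \<bullet> b) * (s h \<bullet> b)) = s k \<bullet> s h" for k h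
    by (rule euclidean_inner[symmetric])
qed

text \<open>The addition formula splits this into two rank one kernels, built from
  \<open>cos (w * t k)\<close> and \<open>sin (w * t k)\<close>.\<close>

lemma schur_psd_cos_diff:
  fixes t :: "'i \<Rightarrow> real"
  shows "schur_psd I (\<lambda>k h. cos (w * (t k - t h)))"
  unfolding right_diff_distrib cos_diff by (intro schur_psd_add schur_psd_rank_one)

text \<open>Binomial series with exponent -1/2, in Pochhammer form so that the coefficients are
  visibly nonnegative.\<close>

lemma inverse_sqrt_power_series:
  fixes z :: real
  assumes "\<bar>z\<bar> < 1"
  shows "(\<lambda>n. pochhammer (1/2) n / fact n * z ^ n) sums (1 / sqrt (1 - z))"
proof -
  have "((-1/2::real) gchoose n) * (- z) ^ n = pochhammer (1/2) n / fact n * z ^ n" for n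
  proof -
    have "((-1/2::real) gchoose n) = (-1) ^ n * pochhammer (1/2) n / fact n"
      by (simp add: gbinomial_pochhammer)
    moreover have "(- z) ^ n = (-1) ^ n * z ^ n"
      by (rule power_minus)
    \<comment> \<open>The sign in the binomial coefficient cancels the one in
      \<open>(- z) ^ n\<close>.\<close>
    moreover have "(-1::real) ^ n * (-1) ^ n = 1"
      by (simp flip: power_mult_distrib)
    ultimately show ?thesis
      by simp
  qed
  moreover have "(1 - z) powr (-1/2) = 1 / sqrt (1 - z)"
    using assms by (simp add: powr_minus_divide powr_half_sqrt)
  ultimately show ?thesis
    using gen_binomial_real[of "-z" "-1/2"] assms by simp
qed

text \<open>Taking \<open>r < 1\<close> keeps \<open>s * t\<close> strictly between -1 and 1, where
  arcsin is differentiable, even if \<open>\<bar>t\<bar> = 1\<close>.\<close>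

lemma arcsin_has_integral:
  fixes r t :: real
  assumes "0 \<le> r" "r < 1" "\<bar>t\<bar> \<le> 1"
  shows "((\<lambda>s. t * (1 / sqrt (1 - (s * t)\<^sup>2))) has_integral arcsin (r * t)) {0..r}"
proof -
  have "((\<lambda>s. t * (1 / sqrt (1 - (s * t)\<^sup>2))) has_integral (arcsin (r * t) - arcsin (0 * t))) {0..r}"
  proof (rule fundamental_theorem_of_calculus[OF \<open>0 \<le> r\<close>])
    fix s assume s: "s \<in> {0..r}"
    have "\<bar>s * t\<bar> \<le> r * 1"
      unfolding abs_mult using s assms by (intro mult_mono) auto
    then have "- 1 < s * t" "s * t < 1" using assms by auto
    then have "((\<lambda>s. arcsin (s * t)) has_real_derivative t * (1 / sqrt (1 - (s * t)\<^sup>2))) (at s)"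
      by (auto intro!: derivative_eq_intros simp: field_simps)
    then show "((\<lambda>s. arcsin (s * t)) has_vector_derivative t * (1 / sqrt (1 - (s * t)\<^sup>2)))
        (at s within {0..r})"
      by (simp add: has_real_derivative_iff_has_vector_derivative has_vector_derivative_at_within)
  qed
  then show ?thesis by simp
qed

text \<open>Entries of modulus 1 occur for equal or antipodal points, and there the binomial series
  reaches its singularity. Hence the kernel is first scaled by \<open>r < 1\<close>.\<close>

lemma schur_psd_arcsin:
  assumes "finite I" and K: "schur_psd I K" and le1: "\<And>k h. k \<in> I \<Longrightarrow> h \<in> I \<Longrightarrow> \<bar>K k h\<bar> \<le> 1"
  shows "schur_psd I (\<lambda>k h. arcsin (K k h))"
proof (rule schur_psd_tendsto[where F = "at_left 1"])
  have cont: "continuous_on {-1..1} (\<lambda>t::real. arcsin t)" by (rule continuous_on_arcsin')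
  show "((\<lambda>r. arcsin (r * K k h)) \<longlongrightarrow> arcsin (K k h)) (at_left 1)" if "k \<in> I" "h \<in> I" for k h
  proof -
    \<comment> \<open>arcsin is continuous on [-1, 1] only, so the limit is taken within [0, 1],
      where \<open>r * K k h\<close> stays in that interval.\<close>
    have "\<bar>r * K k h\<bar> \<le> 1" if "r \<in> {0..1}" for r
      unfolding abs_mult using that le1[OF \<open>k \<in> I\<close> \<open>h \<in> I\<close>] by (intro mult_le_one) auto
    then have "continuous_on {0..1} (\<lambda>r. arcsin (r * K k h))"
      by (intro continuous_on_compose2[OF cont] continuous_intros) (auto simp: abs_le_iff)
    then have "((\<lambda>r. arcsin (r * K k h)) \<longlongrightarrow> arcsin (1 * K k h)) (at 1 within {0..1})"
      unfolding continuous_on_def by (rule bspec) simp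
    then show ?thesis by (simp add: at_within_Icc_at_left)
  qed
  have "schur_psd I (\<lambda>k h. arcsin (r * K k h))" if r: "r \<in> {0<..<1}" for r
  proof (rule schur_psd_has_integral[OF \<open>finite I\<close>])
    show "((\<lambda>s. K k h * (1 / sqrt (1 - (s * K k h)\<^sup>2))) has_integral arcsin (r * K k h)) {0..r}"
      if "k \<in> I" "h \<in> I" for k h
      using r le1[OF that] by (intro arcsin_has_integral) auto
    fix s assume s: "s \<in> {0..r}"
    have "schur_psd I (\<lambda>k h. (s * K k h)\<^sup>2)"
      using s by (intro schur_psd_power schur_psd_cmult K) auto
    then have "schur_psd I (\<lambda>k h. 1 / sqrt (1 - (s * K k h)\<^sup>2))"
    proof (rule schur_psd_power_series)
      fix k h assume kh: "k \<in> I" "h \<in> I"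
      have "\<bar>s * K k h\<bar> \<le> r * 1"
        unfolding abs_mult using s le1[OF kh] by (intro mult_mono) auto
      then have "\<bar>(s * K k h)\<^sup>2\<bar> < 1" using r by (simp add: abs_square_less_1)
      then show "(\<lambda>m. pochhammer (1/2) m / fact m * (s * K k h)\<^sup>2 ^ m) sums (1 / sqrt (1 - (s * K k h)\<^sup>2))"
        by (rule inverse_sqrt_power_series)
    qed (simp add: pochhammer_nonneg)
    with K show "schur_psd I (\<lambda>k h. K k h * (1 / sqrt (1 - (s * K k h)\<^sup>2)))"
      by (rule schur_psd_mult)
  qed
  then show "\<forall>\<^sub>F r in at_left 1. schur_psd I (\<lambda>k h. arcsin (r * K k h))"
    by (intro eventually_at_leftI[of 0]) auto
qed simp

subsection \<open>Functions with completely monotone derivative\<close>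

text \<open>Bernstein's argument: the integral remainder at \<open>y\<close> is at most
  \<open>(y / b) ^ q\<close> times the one at \<open>b\<close>, and the latter is at most
  \<open>f 0 b - f 0 0\<close> for every \<open>q\<close>. Since \<open>y < b\<close>, the remainder
  vanishes in the limit.\<close>

lemma absolutely_monotone_sums:
  fixes f :: "nat \<Rightarrow> real \<Rightarrow> real"
  assumes deriv: "\<And>n x. 0 \<le> x \<Longrightarrow> x \<le> b \<Longrightarrow> (f n has_real_derivative f (Suc n) x) (at x)"
    and nonneg: "\<And>n x. 0 \<le> x \<Longrightarrow> x \<le> b \<Longrightarrow> 0 \<le> f (Suc n) x"
    and y: "0 \<le> y" "y < b"
  shows "(\<lambda>n. f n 0 / fact n * y ^ n) sums f 0 y"
proof -
  define R where "R p z = f 0 z - (\<Sum>i<p. f i 0 / fact i * z ^ i)" for p z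
  have b: "0 < b" using y by simp
  have rem: "((\<lambda>x. (z - x) ^ q / fact q * f (Suc q) x) has_integral R (Suc q) z) {0..z}"
    if "0 \<le> z" "z \<le> b" for q z
  proof -
    have "((\<lambda>x. ((z - x) ^ (Suc q - 1) / fact (Suc q - 1)) *\<^sub>R f (Suc q) x) has_integral
        f 0 z - (\<Sum>i<Suc q. ((z - 0) ^ i / fact i) *\<^sub>R f i 0)) {0..z}"
    proof (rule Taylor_has_integral)
      show "(f m has_vector_derivative f (Suc m) t) (at t within {0..z})"
        if "m < Suc q" "0 \<le> t" "t \<le> z" for m t
        using deriv[of t m] that \<open>z \<le> b\<close>
        by (simp add: has_field_derivative_at_within flip: has_real_derivative_iff_has_vector_derivative)
    qed (use that in auto)
    then show ?thesis by (simp add: R_def mult.commute)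
  qed
  \<comment> \<open>All Taylor terms beyond the constant one are nonnegative, which bounds the
    remainder at \<open>b\<close> by \<open>f 0 b - f 0 0\<close>.\<close>
  have fSuc: "f 0 0 \<le> (\<Sum>i<Suc q. f i 0 / fact i * b ^ i)" for q
    unfolding sum.lessThan_Suc_shift using nonneg[of 0] b
    by (auto intro!: sum_nonneg)
  have R_nonneg: "0 \<le> R (Suc q) y" for q
    by (rule has_integral_nonneg[OF rem]) (use y nonneg in auto)
  have R_le: "R (Suc q) y \<le> (y / b) ^ q * (f 0 b - f 0 0)" for q
  proof -
    \<comment> \<open>The remainder integrand for the endpoint \<open>b\<close>, scaled by
      \<open>(y / b) ^ q\<close>; on [0, y] it dominates the integrand for \<open>y\<close>.\<close>
    define g where "g x = (y / b) ^ q * ((b - x) ^ q / fact q * f (Suc q) x)" for x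
    have g: "(g has_integral (y / b) ^ q * R (Suc q) b) {0..b}"
      unfolding g_def by (intro has_integral_mult_right rem) (use b in auto)
    then have gi: "g integrable_on {0..y}"
      by (rule integrable_on_subinterval[OF has_integral_integrable]) (use y in auto)
    have "R (Suc q) y \<le> integral {0..y} g"
    proof (rule has_integral_le[OF rem])
      show "(g has_integral integral {0..y} g) {0..y}"
        using gi by (rule integrable_integral)
      fix x assume x: "x \<in> {0..y}"
      have "x * y \<le> x * b" using x y by (intro mult_left_mono) auto
      then have "y - x \<le> y / b * (b - x)"
        using b by (simp add: field_simps)
      then have "(y - x) ^ q \<le> (y / b * (b - x)) ^ q"
        using x by (intro power_mono) auto
      then have "(y - x) ^ q \<le> (y / b) ^ q * (b - x) ^ q"
        unfolding power_mult_distrib .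
      then have "(y - x) ^ q * (f (Suc q) x / fact q) \<le> (y / b) ^ q * (b - x) ^ q * (f (Suc q) x / fact q)"
        using nonneg[of x q] x y by (intro mult_right_mono) auto
      then show "(y - x) ^ q / fact q * f (Suc q) x \<le> g x"
        by (simp add: g_def mult_ac)
    qed (use y in auto)
    \<comment> \<open>Since \<open>g\<close> is nonnegative, enlarging the domain from [0, y] to
      [0, b] can only increase the integral.\<close>
    also have "\<dots> \<le> (y / b) ^ q * R (Suc q) b"
    proof (rule has_integral_subset_le[OF _ integrable_integral[OF gi] g])
      show "\<forall>x\<in>{0..b}. 0 \<le> g x"
        unfolding g_def using nonneg b y by auto
    qed (use y in auto)
    also have "\<dots> \<le> (y / b) ^ q * (f 0 b - f 0 0)"
      unfolding R_def using fSuc[of q] y b by (intro mult_left_mono) auto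
    finally show ?thesis .
  qed
  have "(\<lambda>q. (y / b) ^ q * (f 0 b - f 0 0)) \<longlonglongrightarrow> 0 * (f 0 b - f 0 0)"
    using y by (intro tendsto_mult tendsto_const LIMSEQ_power_zero) auto
  then have lim: "(\<lambda>q. (y / b) ^ q * (f 0 b - f 0 0)) \<longlonglongrightarrow> 0"
    by simp
  have "(\<lambda>q. R (Suc q) y) \<longlonglongrightarrow> 0"
    by (rule tendsto_sandwich[OF always_eventually always_eventually tendsto_const lim])
       (intro allI R_nonneg R_le)+
  then have "(\<lambda>q. R q y) \<longlonglongrightarrow> 0"
    by (rule LIMSEQ_imp_Suc)
  then have "(\<lambda>q. f 0 y - R q y) \<longlonglongrightarrow> f 0 y - 0"
    by (intro tendsto_intros)
  then show ?thesis by (simp add: R_def sums_def)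
qed

text \<open>Applied with \<open>m = pi\<close> and \<open>D\<close> the great circle distance. The
  shift by \<open>e > 0\<close> keeps all expansions away from 0, where the derivatives of
  \<open>\<psi>\<close> may be unbounded.\<close>

lemma schur_psd_exp_minus_Bernstein:
  fixes \<psi> :: "real \<Rightarrow> real"
  assumes cont0: "continuous (at_right 0) \<psi>"
    and diff: "\<And>t. t > 0 \<Longrightarrow> \<psi> differentiable (at t)"
    and cm: "completely_monotone (deriv \<psi>)"
    and D: "schur_psd I (\<lambda>k h. m - D k h)"
    and D_range: "\<And>k h. k \<in> I \<Longrightarrow> h \<in> I \<Longrightarrow> 0 \<le> D k h \<and> D k h \<le> m"
    and "0 \<le> m" "0 \<le> c"
  shows "schur_psd I (\<lambda>k h. exp (- (c * \<psi> (D k h))))"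
proof (rule schur_psd_tendsto[where F = "at_right 0"])
  have isCont: "isCont \<psi> t" if "t > 0" for t
    using diff[OF that] by (rule differentiable_imp_continuous_within)
  show "((\<lambda>e. exp (- (c * \<psi> (D k h + e)))) \<longlongrightarrow> exp (- (c * \<psi> (D k h)))) (at_right 0)"
    if "k \<in> I" "h \<in> I" for k h
  proof (intro tendsto_intros)
    show "((\<lambda>e. \<psi> (D k h + e)) \<longlongrightarrow> \<psi> (D k h)) (at_right 0)"
    \<comment> \<open>At 0 only continuity from the right is available, which suffices because
      \<open>e\<close> tends to 0 from above.\<close>
    proof (cases "D k h = 0")
      case True
      with cont0 show ?thesis by (simp add: continuous_within)
    next
      case False
      then have "isCont \<psi> (D k h)" using D_range[OF that] by (intro isCont) auto
      then show ?thesis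
        by (rule isCont_tendsto_compose) (auto intro!: tendsto_eq_intros)
    qed
  qed
  have deriv_\<psi>: "((deriv ^^ n) \<psi> has_real_derivative (deriv ^^ Suc n) \<psi> t) (at t)" if "t > 0" for n t
  proof -
    \<comment> \<open>Complete monotonicity concerns \<open>deriv \<psi>\<close>: order 0 comes from
      \<open>diff\<close>, and order \<open>Suc n'\<close> from order \<open>n'\<close> of
      \<open>deriv \<psi>\<close>.\<close>
    have "(deriv ^^ n) \<psi> differentiable (at t)"
    proof (cases n)
      case 0
      with diff that show ?thesis by simp
    next
      case (Suc n')
      with cm that show ?thesis
        by (simp add: completely_monotone_def funpow_Suc_right del: funpow.simps)
    qed
    then show ?thesis
      by (simp add: DERIV_deriv_iff_real_differentiable)
  qed
  have "schur_psd I (\<lambda>k h. exp (- (c * \<psi> (D k h + e))))" if "e > 0" for e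
  proof -
    define T where "T = m + e"
    \<comment> \<open>The n-th derivative in \<open>y\<close> of
      \<open>\<psi> T - \<psi> (T - y)\<close>. The chain rule sign \<open>(- 1) ^ n\<close> turns
      the alternating signs of complete monotonicity into nonnegativity from order 1 on.\<close>
    define f where "f n y = (if n = 0 then \<psi> T else 0) - (- 1) ^ n * (deriv ^^ n) \<psi> (T - y)" for n y
    have f_nonneg: "0 \<le> f (Suc n) y" if "y < T" for n y
      using cm that unfolding f_def completely_monotone_def
      by (simp add: funpow_Suc_right del: funpow.simps)
    have "schur_psd I (\<lambda>k h. \<psi> T - \<psi> (D k h + e))"
    proof (rule schur_psd_power_series[OF D])
      have "0 < T" using \<open>0 \<le> m\<close> \<open>e > 0\<close> by (simp add: T_def)
      \<comment> \<open>The constant coefficient is \<open>\<psi> T - \<psi> T = 0\<close>.\<close>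
      then show "0 \<le> f n 0 / fact n" for n
        using f_nonneg[of 0] by (cases n) (auto simp: f_def)
      fix k h assume kh: "k \<in> I" "h \<in> I"
      have "(\<lambda>n. f n 0 / fact n * (m - D k h) ^ n) sums f 0 (m - D k h)"
      \<comment> \<open>The radius \<open>m + e / 2\<close> strictly exceeds every
        \<open>m - D k h\<close>, yet stays below \<open>T\<close>, so \<open>T - x\<close> remains
        positive.\<close>
      proof (rule absolutely_monotone_sums[where b = "m + e / 2"])
        fix n x assume "0 \<le> x" "x \<le> m + e / 2"
        then have x: "x < T" using \<open>e > 0\<close> by (simp add: T_def)
        show "0 \<le> f (Suc n) x" using x by (rule f_nonneg)
        have "((\<lambda>y. (deriv ^^ n) \<psi> (T - y)) has_real_derivative (deriv ^^ Suc n) \<psi> (T - x) * (- 1)) (at x)"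
          by (rule DERIV_chain2[OF deriv_\<psi>]) (use x in \<open>auto intro!: derivative_eq_intros\<close>)
        then have "((\<lambda>y. (if n = 0 then \<psi> T else 0) - (- 1) ^ n * (deriv ^^ n) \<psi> (T - y))
            has_real_derivative 0 - (- 1) ^ n * ((deriv ^^ Suc n) \<psi> (T - x) * (- 1))) (at x)"
          by (intro derivative_intros DERIV_cmult)
        then show "(f n has_real_derivative f (Suc n) x) (at x)"
          by (simp add: f_def[abs_def] del: funpow.simps)
      qed (use D_range[OF kh] \<open>e > 0\<close> in auto)
      then show "(\<lambda>n. f n 0 / fact n * (m - D k h) ^ n) sums (\<psi> T - \<psi> (D k h + e))"
        by (simp add: f_def T_def algebra_simps)
    qed
    \<comment> \<open>The exponential is split into a positive constant and the exponential of a
      kernel just shown to be \<open>schur_psd\<close>.\<close>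
    then have "schur_psd I (\<lambda>k h. exp (- (c * \<psi> T)) * exp (c * (\<psi> T - \<psi> (D k h + e))))"
      using \<open>0 \<le> c\<close> by (intro schur_psd_cmult schur_psd_exp) auto
    then show ?thesis
      by (rule schur_psd_cong) (simp add: algebra_simps flip: exp_add)
  qed
  then show "\<forall>\<^sub>F e in at_right 0. schur_psd I (\<lambda>k h. exp (- (c * \<psi> (D k h + e))))"
    by (intro eventually_at_rightI[of 0 1]) auto
qed simp

subsection \<open>Fourier representation\<close>

lemma has_bochner_integral_gaussian:
  "has_bochner_integral lborel (\<lambda>x::real. exp (- x\<^sup>2)) (sqrt pi)"
  using has_bochner_integral_even_function[OF gaussian_moment_0] by simp

lemma integrable_on_gaussian: "(\<lambda>x::real. exp (- x\<^sup>2)) integrable_on {a..}"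
proof -
  have "set_integrable lborel {a..} (\<lambda>x::real. exp (- x\<^sup>2))"
    unfolding set_integrable_def
    using has_bochner_integral_gaussian
    by (intro integrable_mult_indicator) (auto simp: has_bochner_integral_iff)
  then show ?thesis by (rule set_borel_integral_eq_integral)
qed

lemma erfc_nonneg: "0 \<le> erfc t"
  unfolding erfc_def
  by (intro mult_nonneg_nonneg Henstock_Kurzweil_Integration.integral_nonneg integrable_on_gaussian) auto

lemma erfc_has_real_derivative:
  "(erfc has_real_derivative - (2 / sqrt pi * exp (- t\<^sup>2))) (at t)"
proof -
  let ?g = "\<lambda>x::real. exp (- x\<^sup>2)"
  \<comment> \<open>Fixing the base point \<open>t - 1\<close> turns the moving ray, for
    \<open>x\<close> near \<open>t\<close>, into a constant minus an integral over a compact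
    interval.\<close>
  have split: "erfc x = 2 / sqrt pi * (integral {t - 1..} ?g - integral {t - 1..x} ?g)"
    if "t - 1 < x" for x
  proof -
    have "(?g has_integral integral {t - 1..x} ?g + integral {x..} ?g) ({t - 1..x} \<union> {x..})"
      using integrable_on_gaussian[of "t - 1"] that
      by (intro has_integral_Un integrable_integral integrable_on_gaussian
            integrable_on_subinterval[OF integrable_on_gaussian[of "t - 1"]])
         (auto intro: negligible_subset[of "{x}"])
    moreover have "{t - 1..x} \<union> {x..} = {t - 1..}" using that by auto
    ultimately have "integral {t - 1..} ?g = integral {t - 1..x} ?g + integral {x..} ?g"
      by (auto dest: integral_unique)
    then show ?thesis by (simp add: erfc_def)
  qed
  have "((\<lambda>x. integral {t - 1..x} ?g) has_real_derivative ?g t) (at t within {t - 1..t + 1})"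
    by (intro integral_has_real_derivative continuous_intros) auto
  then have "((\<lambda>x. integral {t - 1..x} ?g) has_real_derivative ?g t) (at t)"
    by (simp add: at_within_Icc_at)
  then have "((\<lambda>x. 2 / sqrt pi * (integral {t - 1..} ?g - integral {t - 1..x} ?g))
      has_real_derivative 2 / sqrt pi * (0 - ?g t)) (at t)"
    by (intro DERIV_cmult derivative_intros)
  moreover have "\<forall>\<^sub>F x in nhds t. erfc x = 2 / sqrt pi * (integral {t - 1..} ?g - integral {t - 1..x} ?g)"
  proof (rule eventually_mono)
    show "\<forall>\<^sub>F x in nhds t. x \<in> {t - 1<..}" by (rule eventually_nhds_in_open) auto
    show "erfc x = 2 / sqrt pi * (integral {t - 1..} ?g - integral {t - 1..x} ?g)" if "x \<in> {t - 1<..}" for x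
      using that by (intro split) simp
  qed
  ultimately show ?thesis
    by (subst DERIV_cong_ev[OF refl _ refl]) auto
qed

lemma erfc_tendsto_0: "(erfc \<longlongrightarrow> 0) at_top"
proof (rule tendsto_sandwich)
  show "\<forall>\<^sub>F x in at_top. 0 \<le> erfc x" by (simp add: erfc_nonneg)
  show "\<forall>\<^sub>F x in at_top. erfc x \<le> 2 / sqrt pi * exp (- x)"
  proof (rule eventually_mono[OF eventually_ge_at_top[of 1]])
    fix x :: real assume "1 \<le> x"
    have "((\<lambda>t::real. exp (- 1 * t)) has_integral exp (- 1 * x) / 1) {x..}"
      by (rule has_integral_exp_minus_to_infinity) simp
    then have E: "((\<lambda>t::real. exp (- t)) has_integral exp (- x)) {x..}" by simp
    have "integral {x..} (\<lambda>t. exp (- t\<^sup>2)) \<le> exp (- x)"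
    proof (rule has_integral_le[OF integrable_integral[OF integrable_on_gaussian] E])
      fix t assume "t \<in> {x..}"
      with \<open>1 \<le> x\<close> have "1 * t \<le> t * t" by (intro mult_right_mono) auto
      then show "exp (- t\<^sup>2) \<le> exp (- t)" by (simp add: power2_eq_square)
    qed
    then show "erfc x \<le> 2 / sqrt pi * exp (- x)"
      unfolding erfc_def by (intro mult_left_mono) auto
  qed
  show "((\<lambda>x. 2 / sqrt pi * exp (- x)) \<longlongrightarrow> 0) at_top"
    by real_asymp
qed simp

text \<open>For a nonnegative integrand, a finite limit of the antiderivative gives integrability
  together with the value.\<close>

lemma has_bochner_integral_FTC_atLeast:
  fixes f F :: "real \<Rightarrow> real"
  assumes "f \<in> borel_measurable borel"
    and "\<And>x. a \<le> x \<Longrightarrow> (F has_real_derivative f x) (at x)"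
    and nonneg: "\<And>x. a \<le> x \<Longrightarrow> 0 \<le> f x"
    and lim: "(F \<longlongrightarrow> T) at_top"
  shows "has_bochner_integral lborel (\<lambda>x. indicator {a..} x * f x) (T - F a)"
proof (rule has_bochner_integral_nn_integral)
  show "(\<lambda>x. indicator {a..} x * f x) \<in> borel_measurable lborel"
    using assms(1) by simp
  show "AE x in lborel. 0 \<le> indicator {a..} x * f x"
    using nonneg by (auto split: split_indicator)
  have "F a \<le> F x" if "a \<le> x" for x
    by (rule DERIV_nonneg_imp_nondecreasing[OF that]) (use assms(2) nonneg in blast)
  then have "F a \<le> T"
    by (intro tendsto_lowerbound[OF lim] eventually_at_top_linorderI[of a]) auto
  then show "0 \<le> T - F a" by simp
  have "(\<integral>\<^sup>+x. ennreal (indicator {a..} x * f x) \<partial>lborel)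
      = (\<integral>\<^sup>+x. ennreal (f x) * indicator {a..} x \<partial>lborel)"
    by (intro nn_integral_cong) (auto split: split_indicator)
  also have "\<dots> = ennreal (T - F a)"
    by (rule nn_integral_FTC_atLeast) (use assms in auto)
  finally show "(\<integral>\<^sup>+x. ennreal (indicator {a..} x * f x) \<partial>lborel) = ennreal (T - F a)" .
qed

lemma has_bochner_integral_exp_atLeast:
  fixes p c :: real
  assumes "0 < p"
  shows "has_bochner_integral lborel (\<lambda>s. indicator {c..} s * exp (- (p * s))) (exp (- (p * c)) / p)"
proof -
  have "has_bochner_integral lborel (\<lambda>s. indicator {c..} s * exp (- (p * s))) (0 - (- exp (- (p * c)) / p))"
  proof (rule has_bochner_integral_FTC_atLeast)
    show "((\<lambda>s. - exp (- (p * s)) / p) has_real_derivative exp (- (p * s))) (at s)" for s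
      using assms by (auto intro!: derivative_eq_intros)
    show "((\<lambda>s. - exp (- (p * s)) / p) \<longlongrightarrow> 0) at_top"
      using assms by real_asymp
  qed auto
  then show ?thesis by simp
qed

lemma integrable_gaussian_scaled:
  assumes "0 < s"
  shows "integrable lborel (\<lambda>w::real. exp (- (s * w\<^sup>2)))"
proof -
  have "integrable lborel (\<lambda>w::real. exp (- (0 + sqrt s * w)\<^sup>2))"
    using has_bochner_integral_gaussian assms
    by (intro lborel_integrable_real_affine) (auto simp: has_bochner_integral_iff)
  then show ?thesis using assms by (simp add: power_mult_distrib)
qed

text \<open>This is the real part of the characteristic function of the standard normal
  distribution, after substituting \<open>x = sqrt (2 * s) * w\<close>.\<close>

lemma integral_cos_gaussian:
  assumes "0 < s"
  shows "(LBINT w. cos (w * u) * exp (- (s * w\<^sup>2))) = sqrt (pi / s) * exp (- (u\<^sup>2 / (4 * s)))"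
proof -
  \<comment> \<open>Chosen so that the substitution turns \<open>t * x\<close> into
    \<open>w * u\<close>.\<close>
  define t where "t = u / sqrt (2 * s)"
  have "complex_of_real (exp (- (t\<^sup>2) / 2)) = (CLINT x|std_normal_distribution. iexp (t * x))"
    using char_std_normal_distribution by (simp add: char_def fun_eq_iff)
  also have "\<dots> = (CLINT x|lborel. std_normal_density x *\<^sub>R iexp (t * x))"
    by (rule integral_density) auto
  finally have "exp (- (t\<^sup>2) / 2) = Re (CLINT x|lborel. std_normal_density x *\<^sub>R iexp (t * x))"
    by (metis Re_complex_of_real)
  also have "\<dots> = (LBINT x. Re (std_normal_density x *\<^sub>R iexp (t * x)))"
  proof (rule integral_Re[symmetric])
    have "integrable lborel std_normal_density"
      by (rule integrable_normal_density) simp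
    then show "integrable lborel (\<lambda>x. std_normal_density x *\<^sub>R iexp (t * x))"
      by (rule Bochner_Integration.integrable_bound) (auto simp: norm_mult)
  qed
  also have "\<dots> = (LBINT x. std_normal_density x * cos (t * x))"
    by (simp add: Re_exp)
  also have "\<dots> = sqrt (2 * s) * (LBINT w. std_normal_density (sqrt (2 * s) * w) * cos (t * (sqrt (2 * s) * w)))"
    using lborel_integral_real_affine[of "sqrt (2 * s)" "\<lambda>x. std_normal_density x * cos (t * x)" 0] assms
    by simp
  also have "(\<lambda>w. std_normal_density (sqrt (2 * s) * w) * cos (t * (sqrt (2 * s) * w)))
      = (\<lambda>w. 1 / sqrt (2 * pi) * (cos (w * u) * exp (- (s * w\<^sup>2))))"
  proof
    fix w
    have "t * (sqrt (2 * s) * w) = w * u" using assms by (simp add: t_def)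
    moreover have "- (sqrt (2 * s) * w)\<^sup>2 / 2 = - (s * w\<^sup>2)"
      using assms by (simp add: power_mult_distrib)
    ultimately show "std_normal_density (sqrt (2 * s) * w) * cos (t * (sqrt (2 * s) * w))
        = 1 / sqrt (2 * pi) * (cos (w * u) * exp (- (s * w\<^sup>2)))"
      by (simp only: std_normal_density_def mult_ac)
  qed
  finally have eq: "exp (- (t\<^sup>2) / 2) = sqrt (2 * s) / sqrt (2 * pi) * (LBINT w. cos (w * u) * exp (- (s * w\<^sup>2)))"
    by simp
  have "- (t\<^sup>2) / 2 = - (u\<^sup>2 / (4 * s))"
    using assms by (simp add: t_def power_divide)
  then have "sqrt (pi / s) * exp (- (u\<^sup>2 / (4 * s)))
      = sqrt (pi / s) * (sqrt (2 * s) / sqrt (2 * pi)) * (LBINT w. cos (w * u) * exp (- (s * w\<^sup>2)))"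
    using eq by (simp only: mult.assoc)
  also have "sqrt (pi / s) * (sqrt (2 * s) / sqrt (2 * pi)) = 1"
    using assms by (simp add: real_sqrt_mult real_sqrt_divide)
  finally show ?thesis by simp
qed

section \<open>The covariance kernel as a function of \<open>c\<close>\<close>

text \<open>Replacing \<open>\<psi> \<theta>\<close> by a free variable \<open>c\<close> allows
  differentiation in \<open>c\<close>.\<close>

definition erfc_kernel :: "real \<Rightarrow> real \<Rightarrow> real" where
  "erfc_kernel c u = exp (- \<bar>u\<bar>) * erfc (sqrt c - \<bar>u\<bar> / (2 * sqrt c))
     + exp \<bar>u\<bar> * erfc (sqrt c + \<bar>u\<bar> / (2 * sqrt c))"

text \<open>The derivative is written to match \<open>integral_cos_gaussian\<close> at
  \<open>s = c\<close>, so that it becomes a cosine integral.\<close>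

lemma erfc_kernel_has_real_derivative:
  assumes "0 < c"
  shows "((\<lambda>c. erfc_kernel c u) has_real_derivative
    - (2 / pi * (exp (- c) * (sqrt (pi / c) * exp (- (u\<^sup>2 / (4 * c))))))) (at c)"
proof -
  define r where "r = sqrt c"
  have r: "0 < r" "c = r\<^sup>2" using assms by (simp_all add: r_def)
  define v where "v = \<bar>u\<bar>"
  have u: "u\<^sup>2 = v\<^sup>2" by (simp add: v_def)
  have dsqrt: "(sqrt has_real_derivative 1 / (2 * r)) (at c)"
    using DERIV_real_sqrt[OF assms] by (simp add: r_def field_simps)
  have dinv: "((\<lambda>c. v / (2 * sqrt c)) has_real_derivative - (v / (4 * r ^ 3))) (at c)"
    by (rule DERIV_cong[OF DERIV_divide[OF DERIV_const DERIV_cmult[OF dsqrt]]])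
       (use r(1) in \<open>simp_all add: r_def[symmetric] field_simps power3_eq_cube\<close>)
  have d1: "((\<lambda>c. sqrt c - v / (2 * sqrt c)) has_real_derivative 1 / (2 * r) + v / (4 * r ^ 3)) (at c)"
    using DERIV_diff[OF dsqrt dinv] by simp
  have d2: "((\<lambda>c. sqrt c + v / (2 * sqrt c)) has_real_derivative 1 / (2 * r) - v / (4 * r ^ 3)) (at c)"
    using DERIV_add[OF dsqrt dinv] by simp
  define E where "E = exp (- c) * exp (- (u\<^sup>2 / (4 * c)))"
  \<comment> \<open>The cross term of the square cancels the prefactor \<open>exp (- v)\<close> or
    \<open>exp v\<close>, so both summands share one exponential.\<close>
  have E: "exp (- v) * exp (- (r - v / (2 * r))\<^sup>2) = E" "exp v * exp (- (r + v / (2 * r))\<^sup>2) = E"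
    unfolding E_def exp_add[symmetric] using r(1) u
    by (simp_all add: r(2) power2_eq_square field_simps)
  have "((\<lambda>c. erfc_kernel c u) has_real_derivative
      exp (- v) * (- (2 / sqrt pi * exp (- (r - v / (2 * r))\<^sup>2)) * (1 / (2 * r) + v / (4 * r ^ 3)))
      + exp v * (- (2 / sqrt pi * exp (- (r + v / (2 * r))\<^sup>2)) * (1 / (2 * r) - v / (4 * r ^ 3)))) (at c)"
    unfolding erfc_kernel_def v_def[symmetric] r_def
    by (intro DERIV_add DERIV_cmult DERIV_chain2[OF erfc_has_real_derivative]
          d1[unfolded r_def] d2[unfolded r_def])
  moreover have "x * (- (p * y) * d) + x' * (- (p * y') * d') = - (p * (x * y * d + x' * y' * d'))"
    for x x' y y' p d d' :: real
    by (simp add: algebra_simps)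
  ultimately have D: "((\<lambda>c. erfc_kernel c u) has_real_derivative
      - (2 / sqrt pi * (E * (1 / (2 * r) + v / (4 * r ^ 3)) + E * (1 / (2 * r) - v / (4 * r ^ 3))))) (at c)"
    by (simp only: E)
  \<comment> \<open>The derivatives of \<open>v / (2 * sqrt c)\<close> enter with opposite signs and
    cancel.\<close>
  have "E * (1 / (2 * r) + d) + E * (1 / (2 * r) - d) = E / r" for d
    by (simp add: algebra_simps)
  moreover have "2 / sqrt pi * (E / r) = 2 / pi * (exp (- c) * (sqrt (pi / c) * exp (- (u\<^sup>2 / (4 * c)))))"
    using r(1) by (simp add: E_def real_sqrt_divide r_def[symmetric] real_div_sqrt field_simps)
  ultimately show ?thesis using D by (simp only:)
qed

lemma erfc_kernel_tendsto_0: "((\<lambda>c. erfc_kernel c u) \<longlongrightarrow> 0) at_top"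
proof -
  have "((\<lambda>c. erfc_kernel c u) \<longlongrightarrow> exp (- \<bar>u\<bar>) * 0 + exp \<bar>u\<bar> * 0) at_top"
    unfolding erfc_kernel_def
    by (intro tendsto_intros filterlim_compose[OF erfc_tendsto_0]; real_asymp)
  then show ?thesis by simp
qed

text \<open>The negated derivative is a cosine integral over \<open>w\<close>; integrating it over
  \<open>s \<ge> c\<close> and exchanging the order produces the factor 1 / (1 + w^2).\<close>

lemma has_integral_erfc_kernel:
  assumes "0 < c"
  shows "((\<lambda>w. 2 / (pi * (1 + w\<^sup>2)) * (cos (w * u) * exp (- ((1 + w\<^sup>2) * c))))
    has_integral erfc_kernel c u) UNIV"
proof -
  define f where "f w s = indicator {c..} s * (cos (w * u) * exp (- ((1 + w\<^sup>2) * s)))" for w s :: real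
  have pos: "0 < 1 + w\<^sup>2" for w :: real by (simp add: add_pos_nonneg)
  have inner_s: "has_bochner_integral lborel (\<lambda>s. indicator {c..} s * exp (- ((1 + w\<^sup>2) * s)))
      (exp (- ((1 + w\<^sup>2) * c)) / (1 + w\<^sup>2))" for w :: real
    using has_bochner_integral_exp_atLeast[OF pos] .
  have inner_s_cos: "has_bochner_integral lborel (f w)
      (cos (w * u) * (exp (- ((1 + w\<^sup>2) * c)) / (1 + w\<^sup>2)))" for w
    using has_bochner_integral_mult_right[OF inner_s[of w], of "cos (w * u)"]
    by (simp add: f_def[abs_def] mult_ac)
  have inner_w: "(LBINT w. f w s)
      = indicator {c..} s * (exp (- s) * (sqrt (pi / s) * exp (- (u\<^sup>2 / (4 * s)))))" for s
  proof (cases "c \<le> s")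
    case True
    have "f w s = exp (- s) * (cos (w * u) * exp (- (s * w\<^sup>2)))" for w
      using True by (simp add: f_def algebra_simps flip: exp_add)
    then show ?thesis
      using True assms by (simp add: integral_cos_gaussian)
  qed (simp add: f_def)
  \<comment> \<open>The cosine does not depend on \<open>s\<close>, so it is the only source of sign
    and its modulus factors out.\<close>
  have norm_f: "(LBINT s. norm (f w s)) = norm (cos (w * u) * (exp (- ((1 + w\<^sup>2) * c)) / (1 + w\<^sup>2)))" for w
    using pos[of w] has_bochner_integral_mult_right[OF inner_s[of w], of "\<bar>cos (w * u)\<bar>"]
    by (simp add: f_def abs_mult mult_ac has_bochner_integral_iff)
  \<comment> \<open>A Gaussian bound, used for the absolute integrability that Fubini
    requires.\<close>
  have le: "exp (- ((1 + w\<^sup>2) * c)) / (1 + w\<^sup>2) \<le> exp (- (c * w\<^sup>2))" for w :: real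
  proof -
    have "exp (- ((1 + w\<^sup>2) * c)) / (1 + w\<^sup>2) \<le> exp (- ((1 + w\<^sup>2) * c)) / 1"
      using pos[of w] by (intro divide_left_mono) auto
    also have "\<dots> \<le> exp (- (c * w\<^sup>2))" using assms by (simp add: algebra_simps)
    finally show ?thesis .
  qed
  have int: "integrable lborel (\<lambda>w. cos (w * u) * (exp (- ((1 + w\<^sup>2) * c)) / (1 + w\<^sup>2)))"
  proof (rule Bochner_Integration.integrable_bound[OF integrable_gaussian_scaled[OF assms]])
    have "\<bar>cos (w * u)\<bar> * (exp (- ((1 + w\<^sup>2) * c)) / (1 + w\<^sup>2)) \<le> 1 * exp (- (c * w\<^sup>2))" for w
      using pos[of w] by (intro mult_mono le) auto
    then show "AE w in lborel. norm (cos (w * u) * (exp (- ((1 + w\<^sup>2) * c)) / (1 + w\<^sup>2)))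
        \<le> norm (exp (- (c * w\<^sup>2)))"
      by (simp add: abs_mult)
  qed measurable
  have [measurable]: "case_prod f \<in> borel_measurable (lborel \<Otimes>\<^sub>M lborel)"
    unfolding f_def[abs_def] by measurable
  have "integrable (lborel \<Otimes>\<^sub>M lborel) (case_prod f)"
  proof (rule lborel_pair.Fubini_integrable)
    show "integrable lborel (\<lambda>w. LBINT s. norm (case (w, s) of (w, s) \<Rightarrow> f w s))"
      unfolding prod.case norm_f using int by (rule integrable_norm)
    show "AE w in lborel. integrable lborel (\<lambda>s. case (w, s) of (w, s) \<Rightarrow> f w s)"
      using inner_s_cos by (auto simp: has_bochner_integral_iff)
  qed measurable
  from lborel_pair.Fubini_integral[OF this]
  have fubini: "(LBINT s. indicator {c..} s * (exp (- s) * (sqrt (pi / s) * exp (- (u\<^sup>2 / (4 * s))))))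
      = (LBINT w. cos (w * u) * (exp (- ((1 + w\<^sup>2) * c)) / (1 + w\<^sup>2)))"
    unfolding inner_w has_bochner_integral_integral_eq[OF inner_s_cos] .
  \<comment> \<open>The antiderivative is \<open>- erfc_kernel s u\<close>; its limit is left as
    \<open>- 0\<close> to match \<open>tendsto_minus\<close>.\<close>
  have "has_bochner_integral lborel
      (\<lambda>s. indicator {c..} s * (2 / pi * (exp (- s) * (sqrt (pi / s) * exp (- (u\<^sup>2 / (4 * s)))))))
      (- 0 - - erfc_kernel c u)"
  proof (rule has_bochner_integral_FTC_atLeast)
    fix s assume "c \<le> s"
    then have s: "0 < s" using assms by simp
    show "((\<lambda>s. - erfc_kernel s u) has_real_derivative
        2 / pi * (exp (- s) * (sqrt (pi / s) * exp (- (u\<^sup>2 / (4 * s)))))) (at s)"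
      using DERIV_minus[OF erfc_kernel_has_real_derivative[OF s, of u]] by simp
    show "0 \<le> 2 / pi * (exp (- s) * (sqrt (pi / s) * exp (- (u\<^sup>2 / (4 * s)))))"
      using s by simp
  qed (measurable, intro tendsto_minus erfc_kernel_tendsto_0)
  then have "erfc_kernel c u
      = (LBINT s. indicator {c..} s * (2 / pi * (exp (- s) * (sqrt (pi / s) * exp (- (u\<^sup>2 / (4 * s)))))))"
    by (simp only: has_bochner_integral_integral_eq)
  also have "\<dots> = (LBINT s. 2 / pi * (indicator {c..} s * (exp (- s) * (sqrt (pi / s) * exp (- (u\<^sup>2 / (4 * s)))))))"
    by (simp only: mult.left_commute[of "2 / pi"])
  also have "\<dots> = 2 / pi * (LBINT w. cos (w * u) * (exp (- ((1 + w\<^sup>2) * c)) / (1 + w\<^sup>2)))"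
    by (simp only: integral_mult_right_zero fubini)
  finally have "((\<lambda>w. 2 / pi * (cos (w * u) * (exp (- ((1 + w\<^sup>2) * c)) / (1 + w\<^sup>2))))
      has_integral erfc_kernel c u) UNIV"
    using has_integral_mult_right[OF has_integral_integral_lborel[OF int], of "2 / pi"] by (simp only:)
  then show ?thesis by (simp add: mult_ac)
qed

subsection \<open>The covariance function\<close>

theorem theorem3:
  fixes \<psi> :: "real \<Rightarrow> real"
  assumes pos: "\<And>t. t \<ge> 0 \<Longrightarrow> \<psi> t > 0"
    and cont0: "continuous (at_right 0) \<psi>"
    and diff: "\<And>t. t > 0 \<Longrightarrow> \<psi> differentiable (at t)"
    and cm: "completely_monotone (deriv \<psi>)"
    and dim: "DIM('a::euclidean_space) \<ge> 2"
  shows "is_covariance_sphere_time TYPE('a)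
           (\<lambda>\<theta> u. exp (- \<bar>u\<bar>) * erfc (sqrt (\<psi> \<theta>) - \<bar>u\<bar> / (2 * sqrt (\<psi> \<theta>)))
                 + exp \<bar>u\<bar> * erfc (sqrt (\<psi> \<theta>) + \<bar>u\<bar> / (2 * sqrt (\<psi> \<theta>))))"
  unfolding is_covariance_sphere_time_def erfc_kernel_def[symmetric]
proof (intro allI impI)
  fix n :: nat and s :: "nat \<Rightarrow> 'a" and t a :: "nat \<Rightarrow> real"
  assume s: "\<forall>k<n. norm (s k) = 1"
  \<comment> \<open>Keeps the arguments of arccos and arcsin in [-1, 1], where both are genuine
    inverse functions.\<close>
  have inner: "\<bar>s k \<bullet> s h\<bar> \<le> 1" if "k \<in> {..<n}" "h \<in> {..<n}" for k h
    using Cauchy_Schwarz_ineq2[of "s k" "s h"] s that by simp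
  have range: "0 \<le> gc_dist (s k) (s h) \<and> gc_dist (s k) (s h) \<le> pi"
    if "k \<in> {..<n}" "h \<in> {..<n}" for k h
    using inner[OF that] by (auto simp: gc_dist_def abs_le_iff intro: arccos_lbound arccos_ubound)
  have "schur_psd {..<n} (\<lambda>k h. pi / 2 + arcsin (s k \<bullet> s h))"
    using inner by (intro schur_psd_add schur_psd_const schur_psd_arcsin schur_psd_inner) auto
  then have D: "schur_psd {..<n} (\<lambda>k h. pi - gc_dist (s k) (s h))"
    by (rule schur_psd_cong)
       (use inner in \<open>auto simp: gc_dist_def arcsin_arccos_eq abs_le_iff\<close>)
  have "schur_psd {..<n} (\<lambda>k h. erfc_kernel (\<psi> (gc_dist (s k) (s h))) (t k - t h))"
  proof (rule schur_psd_has_integral)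
    fix w :: real
    \<comment> \<open>For fixed \<open>w\<close> this number is the factor \<open>c\<close> of
      \<open>schur_psd_exp_minus_Bernstein\<close>.\<close>
    have "0 \<le> 1 + w\<^sup>2" by simp
    then show "schur_psd {..<n} (\<lambda>k h. 2 / (pi * (1 + w\<^sup>2)) *
        (cos (w * (t k - t h)) * exp (- ((1 + w\<^sup>2) * \<psi> (gc_dist (s k) (s h))))))"
      by (intro schur_psd_cmult schur_psd_mult schur_psd_cos_diff
            schur_psd_exp_minus_Bernstein[OF cont0 diff cm D range]) auto
  next
    fix k h assume "k \<in> {..<n}" "h \<in> {..<n}"
    then show "((\<lambda>w. 2 / (pi * (1 + w\<^sup>2)) *
        (cos (w * (t k - t h)) * exp (- ((1 + w\<^sup>2) * \<psi> (gc_dist (s k) (s h))))))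
        has_integral erfc_kernel (\<psi> (gc_dist (s k) (s h))) (t k - t h)) UNIV"
      using range pos by (intro has_integral_erfc_kernel) auto
  qed simp
  then show "0 \<le> (\<Sum>k<n. \<Sum>h<n. a k * a h * erfc_kernel (\<psi> (gc_dist (s k) (s h))) (t k - t h))"
    using schur_psd_imp_psd unfolding psd_def by blast
qed

end
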